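(* Let $(K_n)_{n=1}^\infty$ be the optimal constants satisfying the multilinear Bohnenblust--Hille inequality for complex scalars, and let $\gamma$ be the Euler--Mascheroni constant. For all $n\ge2$, $$K_{n}<1+\frac{4}{\sqrt{\pi}}\left(1-e^{\gamma/2-1/2}\right)\sum_{j=1}^{n-1}j^{\log_{2}\left(e^{-\gamma/2+1/2}\right)-1}.$$ Numerically, for all $n\ge2$, $$K_n<1+0.44\cdot\sum_{j=1}^{n-1}\frac{1}{j^{0.695025}}.$$
   Context: For a positive integer $n$, $K_n$ denotes the optimal constant in the complex $n$-linear Bohnenblust--Hille inequality, i.e. the smallest $C\in[1,\infty)$ such that $$\left(\sum_{i_1,\ldots,i_n=1}^N |U(e_{i_1},\ldots,e_{i_n})|^{\frac{2n}{n+1}}\right)^{\frac{n+1}{2n}}\le C\,\sup_{z_1,\ldots,z_n\in\mathbb{D}^N}|U(z_1,\ldots,z_n)|$$ for all positive integers $N$ and all $n$-linear forms $U:\mathbb{C}^N\times\cdots\times\mathbb{C}^N\to\mathbb{C}$, where $(e_i)_{i=1}^N$ is the canonical basis of $\mathbb{C}^N$ and $\mathbb{D}^N$ is the open unit polydisc in $\mathbb{C}^N$. Such finite constants exist (Bohnenblust--Hille theorem). The Euler--Mascheroni constant is $\gamma=\lim_{m\to\infty}\left(-\log m+\sum_{k=1}^m \frac1k\right)\approx0.5772$. *)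

theory Defs
  imports "HOL-Analysis.Harmonic_Numbers" "Jordan_Normal_Form.Matrix"
begin

definition multilinear_form :: "nat \<Rightarrow> nat \<Rightarrow> (complex Matrix.vec list \<Rightarrow> complex) \<Rightarrow> bool" where
  "multilinear_form n N U \<longleftrightarrow>
     (\<forall>zs i x y c. length zs = n \<longrightarrow> set zs \<subseteq> carrier_vec N \<longrightarrow> i < n \<longrightarrow>
        x \<in> carrier_vec N \<longrightarrow> y \<in> carrier_vec N \<longrightarrow>
          U (zs[i := x + y]) = U (zs[i := x]) + U (zs[i := y]) \<and>
          U (zs[i := c \<cdot>\<^sub>v x]) = c * U (zs[i := x]))"

definition polydisc :: "nat \<Rightarrow> complex Matrix.vec set" where
  "polydisc N = {z \<in> carrier_vec N. \<forall>k<N. cmod (vec_index z k) < 1}"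

text \<open>The supremum below is a real-valued \<open>Sup\<close>: an \<open>n\<close>-linear form on \<open>\<complex>\<^sup>N\<close> is bounded on
  the polydisc, so it is the genuine supremum.\<close>

definition BH_admissible :: "nat \<Rightarrow> real \<Rightarrow> bool" where
  "BH_admissible n C \<longleftrightarrow>
     1 \<le> C \<and>
     (\<forall>N\<ge>1. \<forall>U. multilinear_form n N U \<longrightarrow>
        (\<Sum>is | length is = n \<and> set is \<subseteq> {..<N}.
            cmod (U (map (unit_vec N) is)) powr (2 * real n / (real n + 1)))
          powr ((real n + 1) / (2 * real n))
        \<le> C * (SUP zs \<in> {zs. length zs = n \<and> set zs \<subseteq> polydisc N}. cmod (U zs)))"

text \<open>The admissible constants form a closed set bounded below by 1, so the least one exists as
  soon as there is any, which is the Bohnenblust--Hille theorem.\<close>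

definition BH_const :: "nat \<Rightarrow> real" where
  "BH_const n = (LEAST C. BH_admissible n C)"

end

theory Submission imports Defs begin

text \<open>
  Write \<open>M = 2703 / 2000\<close>. The bound comes from the recursion
  \<open>K\<^bsub>n+1\<^esub> \<le> M powr (1 / n) * K\<^sub>n\<close>, which with \<open>K\<^sub>1 = 1\<close> gives \<open>K\<^sub>n \<le> M powr harm (n - 1)\<close>.
  Since \<open>harm j \<le> 1 + ln j\<close>, the increments of \<open>M powr harm j\<close> are at most
  \<open>M * ln M * j powr (ln M - 1)\<close>, and \<open>M\<close> is small enough for both the constant \<open>M * ln M\<close> and the
  exponent \<open>ln M\<close> to lie below the ones in the theorem.

  The recursion (lemma \<open>BH_admissible_Suc\<close>) follows the inductive scheme for the
  Bohnenblust--Hille inequality. For an \<open>(n+1)\<close>-linear form \<open>U\<close> and each slot \<open>j\<close>, put random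
  unimodular coordinates into slot \<open>j\<close> and unit vectors into the others. The \<open>n\<close>-linear inequality
  bounds the resulting \<open>p\<close>-th moments, \<open>p = 2 n / (n + 1)\<close>, and a Khinchine inequality turns them
  into mixed \<open>(2, p)\<close>-norms of the coefficients of \<open>U\<close>. Having such a bound for every slot
  controls the \<open>2 (n + 1) / (n + 2)\<close>-norm of the coefficients (lemma \<open>blei\<close>).

  What matters is the quality of the Khinchine constant. Interpolating between the moments of order
  \<open>p\<close>, \<open>2\<close> and \<open>4\<close> would give \<open>2 powr (1 / (2 * n))\<close>, that is growth of order
  \<open>n powr (ln 2 / 2)\<close>, more than the order \<open>n powr ((1 - euler_mascheroni) / (2 * ln 2))\<close> of the theorem. Interpolating between \<open>p\<close>, \<open>2\<close> and \<open>3\<close> is good enough, and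
  the third absolute moment needs to be known only up to a small error: with \<open>X\<close> the squared modulus
  of the random sum, \<open>X powr (3 / 2)\<close> is dominated by a quartic polynomial in \<open>X\<close> that touches it at
  two points, and the expectation of that polynomial only grows when the independent unimodular
  variables are replaced by complex Gaussians of the same variance (lemma
  \<open>gauss_quartic_root5_mean\<close>). The Gaussian value of the polynomial is \<open>M\<close>.
  Because only moments of \<open>X\<close> up to order four occur, fifth roots of unity do the work of uniformly
  distributed unimodular variables, and all expectations are finite averages.
\<close>

section \<open>Multi-indices\<close>


definition multi_indices :: "nat \<Rightarrow> nat \<Rightarrow> nat list set" where
  "multi_indices N n = {is. length is = n \<and> set is \<subseteq> {..<N}}"

definition insert_at :: "nat \<Rightarrow> 'a \<Rightarrow> 'a list \<Rightarrow> 'a list" where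
  "insert_at j x l = take j l @ x # drop j l"

definition delete_at :: "nat \<Rightarrow> 'a list \<Rightarrow> 'a list" where
  "delete_at j l = take j l @ drop (Suc j) l"

lemma finite_multi_indices [simp]: "finite (multi_indices N n)"
  using finite_lists_length_eq[of "{..<N}" n]
  by (simp add: multi_indices_def conj_commute)

lemma card_multi_indices [simp]: "card (multi_indices N n) = N ^ n"
  using card_lists_length_eq[of "{..<N}" n]
  by (simp add: multi_indices_def conj_commute)

lemma multi_indices_0 [simp]: "multi_indices N 0 = {[]}"
  by (auto simp: multi_indices_def)

lemma length_insert_at [simp]: "length (insert_at j x l) = Suc (length l)"
  by (simp add: insert_at_def)

lemma set_insert_at [simp]: "set (insert_at j x l) = insert x (set l)"
proof -
  have "set l = set (take j l) \<union> set (drop j l)"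
    by (metis append_take_drop_id set_append)
  then show ?thesis
    by (auto simp: insert_at_def)
qed

lemma map_insert_at: "map f (insert_at j x l) = insert_at j (f x) (map f l)"
  by (simp add: insert_at_def take_map drop_map)

lemma delete_insert_at [simp]: "j \<le> length l \<Longrightarrow> delete_at j (insert_at j x l) = l"
  by (simp add: insert_at_def delete_at_def)

lemma nth_insert_at [simp]: "j \<le> length l \<Longrightarrow> insert_at j x l ! j = x"
  by (simp add: insert_at_def nth_append)

lemma insert_delete_at [simp]: "j < length l \<Longrightarrow> insert_at j (l ! j) (delete_at j l) = l"
  by (simp add: insert_at_def delete_at_def id_take_nth_drop[symmetric])

lemma insert_at_update_same:
  "j \<le> length l \<Longrightarrow> (insert_at j x l)[j := y] = insert_at j y l"
  by (simp add: insert_at_def list_update_append)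

lemma insert_at_update:
  assumes "j \<le> length l" "i < length l"
  shows "insert_at j x (l[i := y]) = (insert_at j x l)[(if i < j then i else Suc i) := y]"
  using assms
  by (auto simp: insert_at_def list_update_append take_update_swap list_update_beyond drop_update_swap min_def
      Suc_diff_le)

lemma delete_at_multi_indices:
  "\<lbrakk>l \<in> multi_indices N (Suc n); j \<le> n\<rbrakk> \<Longrightarrow> delete_at j l \<in> multi_indices N n"
  by (auto simp: multi_indices_def delete_at_def dest: in_set_takeD in_set_dropD)

lemma sum_multi_indices_insert:
  assumes "j \<le> n"
  shows "(\<Sum>l\<in>multi_indices N (Suc n). F l)
    = (\<Sum>l\<in>multi_indices N n. \<Sum>x<N. F (insert_at j x l))"
proof -
  have "(\<Sum>l\<in>multi_indices N n. \<Sum>x<N. F (insert_at j x l))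
    = (\<Sum>(l, x)\<in>multi_indices N n \<times> {..<N}. F (insert_at j x l))"
    by (simp add: sum.cartesian_product)
  also have "\<dots> = (\<Sum>l\<in>multi_indices N (Suc n). F l)"
  proof (rule sum.reindex_bij_witness[where i = "\<lambda>l. (delete_at j l, l ! j)"
        and j = "\<lambda>(l, x). insert_at j x l"])
    fix l assume "l \<in> multi_indices N (Suc n)"
    then show "(delete_at j l, l ! j) \<in> multi_indices N n \<times> {..<N}"
      using assms delete_at_multi_indices[of l N n j]
      by (auto simp: multi_indices_def subset_iff)
  qed (use assms in \<open>auto simp: multi_indices_def\<close>)
  finally show ?thesis by simp
qed

lemma sum_multi_indices_snoc:
  "(\<Sum>l\<in>multi_indices N (Suc n). F l) = (\<Sum>l\<in>multi_indices N n. \<Sum>x<N. F (l @ [x]))"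
proof -
  have "insert_at n x l = l @ [x]" if "l \<in> multi_indices N n" for x l
    using that by (simp add: insert_at_def multi_indices_def)
  then show ?thesis
    by (simp add: sum_multi_indices_insert[of n] cong: sum.cong)
qed

section \<open>The Loomis--Whitney and Blei inequalities\<close>

text \<open>
  Hoelder's inequality for several factors with equal exponents. After normalising each sum to one
  it is the arithmetic-geometric mean inequality, summed over \<open>X\<close>.
\<close>

lemma sum_prod_powr_le_prod_sum_powr:
  fixes f :: "'a \<Rightarrow> 'b \<Rightarrow> real"
  assumes J: "finite J" "J \<noteq> {}" and X: "finite X"
    and f: "\<And>j x. \<lbrakk>j \<in> J; x \<in> X\<rbrakk> \<Longrightarrow> 0 \<le> f j x"
  shows "(\<Sum>x\<in>X. \<Prod>j\<in>J. f j x powr (1 / card J)) \<le> (\<Prod>j\<in>J. (\<Sum>x\<in>X. f j x) powr (1 / card J))"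
proof (cases "\<exists>j\<in>J. (\<Sum>x\<in>X. f j x) = 0")
  case True
  then obtain j where j: "j \<in> J" "(\<Sum>x\<in>X. f j x) = 0" by blast
  then have "f j x = 0" if "x \<in> X" for x
    using that f X by (simp add: sum_nonneg_eq_0_iff)
  then have "(\<Prod>j\<in>J. f j x powr (1 / card J)) = 0" if "x \<in> X" for x
    using that j J by (intro prod_zero) auto
  then show ?thesis by (simp add: prod_nonneg)
next
  case False
  define S where "S = (\<lambda>j. \<Sum>x\<in>X. f j x)"
  have S: "S j > 0" if "j \<in> J" for j
    using False that f by (force simp: S_def less_le intro: sum_nonneg)
  have card: "card J > 0" using J by (simp add: card_gt_0_iff)
  define P where "P = (\<Prod>j\<in>J. S j powr (1 / card J))"
  have term_le: "(\<Prod>j\<in>J. f j x powr (1 / card J)) \<le> P * (\<Sum>j\<in>J. f j x / S j / card J)"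
    if x: "x \<in> X" for x
  proof -
    have "(\<Prod>j\<in>J. f j x powr (1 / card J)) = (\<Prod>j\<in>J. S j powr (1 / card J) * (f j x / S j) powr (1 / card J))"
    proof (rule prod.cong[OF refl])
      fix j assume "j \<in> J"
      then show "f j x powr (1 / card J) = S j powr (1 / card J) * (f j x / S j) powr (1 / card J)"
        using S[of j] f[of j x] x by (simp flip: powr_mult)
    qed
    also have "\<dots> = P * (\<Prod>j\<in>J. f j x / S j) powr (1 / card J)"
      by (simp add: P_def prod.distrib prod_powr_distrib)
    also have "\<dots> \<le> P * (\<Sum>j\<in>J. f j x / S j / card J)"
      using arith_geom_mean[of J "\<lambda>j. f j x / S j"] J f x S
      by (intro mult_left_mono) (auto simp: P_def less_imp_le intro!: prod_nonneg)
    finally show ?thesis .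
  qed
  have "(\<Sum>x\<in>X. \<Prod>j\<in>J. f j x powr (1 / card J)) \<le> (\<Sum>x\<in>X. P * (\<Sum>j\<in>J. f j x / S j / card J))"
    by (intro sum_mono term_le)
  also have "\<dots> = P * (\<Sum>j\<in>J. \<Sum>x\<in>X. f j x / S j / card J)"
    by (simp add: sum_distrib_left[symmetric] sum.swap[of _ J X])
  also have "(\<Sum>j\<in>J. \<Sum>x\<in>X. f j x / S j / card J) = (\<Sum>j\<in>J. 1 / card J)"
  proof (rule sum.cong[OF refl])
    fix j assume "j \<in> J"
    then show "(\<Sum>x\<in>X. f j x / S j / card J) = 1 / card J"
      using S[of j] by (simp add: sum_divide_distrib[symmetric]) (simp add: S_def)
  qed
  also have "\<dots> = 1" using card by simp
  finally show ?thesis by (simp add: P_def S_def)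
qed

text \<open>
  Coordinates are summed out one at a time, the last one first; \<open>k\<close> is the number of coordinates
  still present. The factors with index below \<open>k\<close> do not involve their own coordinate; those with
  index at least \<open>k\<close> are functions of the whole remaining index, which the statement expresses through
  \<open>delete_at j l = l\<close> for \<open>j \<ge> length l\<close>. Hence all factors but one depend on the coordinate being
  summed, and exactly \<open>n\<close> exponents \<open>1 / n\<close> take part in Hoelder's inequality.
\<close>

lemma loomis_whitney_partial:
  fixes f :: "nat \<Rightarrow> nat list \<Rightarrow> real"
  assumes "n \<ge> 1" "k \<le> Suc n" "\<And>j l. 0 \<le> f j l"
  shows "(\<Sum>l\<in>multi_indices N k. \<Prod>j<Suc n. f j (delete_at j l) powr (1 / n))
    \<le> (\<Prod>j<Suc n. (\<Sum>l\<in>multi_indices N (if j < k then k - 1 else k). f j l) powr (1 / n))"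
  using assms(2,3)
proof (induction k arbitrary: f)
  case 0
  then show ?case by (simp add: delete_at_def)
next
  case (Suc k)
  define g where "g = (\<lambda>j l. if j = k then f k l else \<Sum>x<N. f j (l @ [x]))"
  have g: "0 \<le> g j l" for j l
    using Suc.prems(2) by (auto simp: g_def intro: sum_nonneg)
  define J where "J = {..<Suc n} - {k}"
  have J: "finite J" "card J = n" "k \<notin> J" "{..<Suc n} = insert k J"
    using Suc.prems(1) unfolding J_def by (auto simp: card_Diff_singleton)
  have J_ne: "J \<noteq> {}"
    using J(2) assms(1) by auto
  have step: "(\<Sum>x<N. \<Prod>j<Suc n. f j (delete_at j (l @ [x])) powr (1 / n))
      \<le> (\<Prod>j<Suc n. g j (delete_at j l) powr (1 / n))" if l: "l \<in> multi_indices N k" for l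
  proof -
    have len: "length l = k" using l by (simp add: multi_indices_def)
    have del_k: "delete_at k (l @ [x]) = l" "delete_at k l = l" for x
      using len by (simp_all add: delete_at_def)
    have del: "delete_at j (l @ [x]) = delete_at j l @ [x]" if "j \<in> J" for j x
      using that len by (cases "j < k") (auto simp: delete_at_def J_def)
    have "(\<Sum>x<N. \<Prod>j<Suc n. f j (delete_at j (l @ [x])) powr (1 / n))
      = f k l powr (1 / n) * (\<Sum>x<N. \<Prod>j\<in>J. f j (delete_at j l @ [x]) powr (1 / n))"
      using J by (simp add: del del_k sum_distrib_left cong: prod.cong)
    also have "\<dots> \<le> f k l powr (1 / n) * (\<Prod>j\<in>J. (\<Sum>x<N. f j (delete_at j l @ [x])) powr (1 / n))"
      using sum_prod_powr_le_prod_sum_powr[of J "{..<N}" "\<lambda>j x. f j (delete_at j l @ [x])"]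
        J J_ne Suc.prems(2) by (intro mult_left_mono) auto
    also have "\<dots> = f k l powr (1 / n) * (\<Prod>j\<in>J. g j (delete_at j l) powr (1 / n))"
      using J(3) by (intro arg_cong2[of _ _ _ _ "(*)"] refl prod.cong) (auto simp: g_def)
    also have "\<dots> = (\<Prod>j<Suc n. g j (delete_at j l) powr (1 / n))"
      using J by (simp add: del_k) (simp add: g_def)
    finally show ?thesis .
  qed
  have "(\<Sum>l\<in>multi_indices N (Suc k). \<Prod>j<Suc n. f j (delete_at j l) powr (1 / n))
    \<le> (\<Sum>l\<in>multi_indices N k. \<Prod>j<Suc n. g j (delete_at j l) powr (1 / n))"
    unfolding sum_multi_indices_snoc by (intro sum_mono step)
  also have "\<dots> \<le> (\<Prod>j<Suc n. (\<Sum>l\<in>multi_indices N (if j < k then k - 1 else k). g j l) powr (1 / n))"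
    using Suc.prems(1) g by (intro Suc.IH) auto
  also have "\<dots> = (\<Prod>j<Suc n. (\<Sum>l\<in>multi_indices N (if j < Suc k then Suc k - 1 else Suc k). f j l) powr (1 / n))"
  proof (rule prod.cong[OF refl])
    fix j assume "j \<in> {..<Suc n}"
    have "(\<Sum>l\<in>multi_indices N (if j < k then k - 1 else k). g j l)
       = (\<Sum>l\<in>multi_indices N (if j < Suc k then Suc k - 1 else Suc k). f j l)"
      using sum_multi_indices_snoc[of "f j" N "k - 1"] sum_multi_indices_snoc[of "f j" N k]
      by (cases j k rule: linorder_cases) (auto simp: g_def)
    then show "(\<Sum>l\<in>multi_indices N (if j < k then k - 1 else k). g j l) powr (1 / n)
       = (\<Sum>l\<in>multi_indices N (if j < Suc k then Suc k - 1 else Suc k). f j l) powr (1 / n)"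
      by simp
  qed
  finally show ?case .
qed

lemma loomis_whitney:
  fixes f :: "nat \<Rightarrow> nat list \<Rightarrow> real"
  assumes "n \<ge> 1" "\<And>j l. 0 \<le> f j l"
  shows "(\<Sum>l\<in>multi_indices N (Suc n). \<Prod>j<Suc n. f j (delete_at j l) powr (1 / n))
    \<le> (\<Prod>j<Suc n. (\<Sum>l\<in>multi_indices N n. f j l) powr (1 / n))"
  using loomis_whitney_partial[of n "Suc n" f N] assms by simp

text \<open>
  With \<open>m = n + 1\<close>, the power \<open>a powr (2 m / (m + 1))\<close> is the geometric mean of the \<open>m + 1\<close>
  quantities \<open>a\<^sup>2 * g\<^sub>j powr (- 2 / m)\<close>, \<open>j < m\<close>, and \<open>\<Prod>j. g\<^sub>j powr (2 / m)\<close>: the product of all of them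
  is \<open>a powr (2 m)\<close>. Summing the arithmetic mean instead, each of the first \<open>m\<close>
  collapses to \<open>\<Sum> g\<^sub>j powr p\<close>, because \<open>g\<^sub>j\<^sup>2\<close> is the sum of \<open>a\<^sup>2\<close> over the coordinate \<open>j\<close>, and the last
  one is bounded by the Loomis--Whitney inequality. The normalisation to \<open>1\<close> is what allows the
  arithmetic mean to replace Hoelder's inequality here.
\<close>

lemma blei_normalized:
  fixes a :: "nat list \<Rightarrow> real" and n N :: nat
  defines "g \<equiv> \<lambda>j l. sqrt (\<Sum>x<N. (a (insert_at j x l))\<^sup>2)"
  assumes n: "n \<ge> 1" and a: "\<And>l. 0 \<le> a l"
    and g_le: "\<And>j. j \<le> n \<Longrightarrow> (\<Sum>l\<in>multi_indices N n. g j l powr (2 * real n / (real n + 1))) \<le> 1"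
  shows "(\<Sum>l\<in>multi_indices N (Suc n). a l powr (2 * (real n + 1) / (real n + 2))) \<le> 1"
proof -
  define m where "m = real n + 1"
  have m: "m > 1" using n by (simp add: m_def)
  have g0: "0 \<le> g j l" for j l by (simp add: g_def sum_nonneg)
  define h where "h = (\<lambda>j l. g j l powr (2 * real n / (real n + 1)))"
  define T where "T = (\<lambda>j l. (a l)\<^sup>2 * g j (delete_at j l) powr (- 2 / m))"
  define R where "R = (\<lambda>l. \<Prod>j<Suc n. h j (delete_at j l) powr (1 / n))"
  have T0: "0 \<le> T j l" for j l by (simp add: T_def)
  have R0: "0 \<le> R l" for l by (simp add: R_def prod_nonneg)
  have pointwise: "a l powr (2 * (real n + 1) / (real n + 2)) \<le> ((\<Sum>j<Suc n. T j l) + R l) / (real n + 2)"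
    if l: "l \<in> multi_indices N (Suc n)" for l
  proof (cases "a l = 0")
    case True
    then show ?thesis using T0 R0 by (simp add: sum_nonneg)
  next
    case False
    then have al: "a l > 0" using a[of l] by simp
    have gpos: "g j (delete_at j l) > 0" if j: "j < Suc n" for j
    proof -
      have "l ! j < N" "insert_at j (l ! j) (delete_at j l) = l"
        using l j by (auto simp: multi_indices_def subset_iff)
      then have "(a l)\<^sup>2 \<le> (\<Sum>x<N. (a (insert_at j x (delete_at j l)))\<^sup>2)"
        using member_le_sum[of "l ! j" "{..<N}" "\<lambda>x. (a (insert_at j x (delete_at j l)))\<^sup>2"] by simp
      moreover have "(a l)\<^sup>2 > 0" using al by simp
      ultimately have "(\<Sum>x<N. (a (insert_at j x (delete_at j l)))\<^sup>2) > 0" by linarith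
      then show ?thesis by (simp add: g_def)
    qed
    define y where "y = (\<lambda>j. if j < Suc n then T j l else R l)"
    have R_eq: "R l = (\<Prod>j<Suc n. g j (delete_at j l) powr (2 / m))"
      unfolding R_def h_def using n by (intro prod.cong refl) (simp add: powr_powr m_def add.commute)
    have "(\<Prod>j<Suc (Suc n). y j) = (\<Prod>j<Suc n. y j) * y (Suc n)"
      by (rule prod.lessThan_Suc)
    also have "\<dots> = (\<Prod>j<Suc n. T j l) * R l"
      by (simp add: y_def del: prod.lessThan_Suc)
    also have "\<dots> = (\<Prod>j<Suc n. (a l)\<^sup>2)"
      unfolding R_eq prod.distrib[symmetric]
    proof (intro prod.cong refl)
      fix j assume "j \<in> {..<Suc n}"
      then have "g j (delete_at j l) > 0" using gpos by simp
      then show "T j l * g j (delete_at j l) powr (2 / m) = (a l)\<^sup>2"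
        by (simp add: T_def mult.assoc flip: powr_add)
    qed
    also have "\<dots> = a l powr (2 * (real n + 1))"
    proof -
      have "(\<Prod>j<Suc n. (a l)\<^sup>2) = a l ^ (2 * (n + 1))"
        by (simp only: prod_constant card_lessThan power_mult[symmetric] Suc_eq_plus1)
      also have "\<dots> = a l powr real (2 * (n + 1))"
        using al by (rule powr_realpow[symmetric])
      finally show ?thesis by (simp add: algebra_simps)
    qed
    finally have "a l powr (2 * (real n + 1) / (real n + 2)) = (\<Prod>j<Suc (Suc n). y j) powr (1 / card {..<Suc (Suc n)})"
      by (simp only: powr_powr card_lessThan) (simp add: add.commute)
    also have "\<dots> \<le> (\<Sum>j<Suc (Suc n). y j / card {..<Suc (Suc n)})"
      by (intro arith_geom_mean) (auto simp: y_def T0 R0)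
    also have "\<dots> = (\<Sum>j<Suc (Suc n). y j) / (real n + 2)"
      by (simp add: sum_divide_distrib add.commute del: sum.lessThan_Suc)
    also have "(\<Sum>j<Suc (Suc n). y j) = (\<Sum>j<Suc n. T j l) + R l"
      by (subst sum.lessThan_Suc) (simp add: y_def del: sum.lessThan_Suc)
    finally show ?thesis .
  qed
  have sumT: "(\<Sum>l\<in>multi_indices N (Suc n). T j l) \<le> 1" if j: "j \<le> n" for j
  proof -
    have "(\<Sum>l\<in>multi_indices N (Suc n). T j l)
      = (\<Sum>l\<in>multi_indices N n. \<Sum>x<N. (a (insert_at j x l))\<^sup>2 * g j l powr (- 2 / m))"
      unfolding sum_multi_indices_insert[OF j] T_def using j
      by (intro sum.cong refl) (simp add: multi_indices_def)
    also have "\<dots> = (\<Sum>l\<in>multi_indices N n. (g j l)\<^sup>2 * g j l powr (- 2 / m))"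
      by (simp add: g_def sum_nonneg flip: sum_distrib_right)
    also have "\<dots> = (\<Sum>l\<in>multi_indices N n. g j l powr (2 * real n / (real n + 1)))"
    proof (intro sum.cong refl)
      fix l
      show "(g j l)\<^sup>2 * g j l powr (- 2 / m) = g j l powr (2 * real n / (real n + 1))"
      proof (cases "g j l = 0")
        case False
        then have "g j l > 0" using g0[of j l] by simp
        moreover have "2 + - 2 / m = 2 * real n / (real n + 1)"
          by (simp add: m_def field_simps)
        ultimately show ?thesis
          by (simp add: powr_add[symmetric] flip: powr_numeral)
      qed simp
    qed
    also have "\<dots> \<le> 1" using g_le[OF j] .
    finally show ?thesis .
  qed
  have sumR: "(\<Sum>l\<in>multi_indices N (Suc n). R l) \<le> 1"
  proof -
    have "(\<Sum>l\<in>multi_indices N (Suc n). R l) \<le> (\<Prod>j<Suc n. (\<Sum>l\<in>multi_indices N n. h j l) powr (1 / n))"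
      unfolding R_def by (rule loomis_whitney) (use n in \<open>auto simp: h_def\<close>)
    also have "\<dots> \<le> (\<Prod>j<Suc n. 1)"
      using g_le by (intro prod_mono conjI powr_le1) (auto simp: h_def sum_nonneg)
    finally show ?thesis by simp
  qed
  have "(\<Sum>l\<in>multi_indices N (Suc n). a l powr (2 * (real n + 1) / (real n + 2)))
    \<le> (\<Sum>l\<in>multi_indices N (Suc n). ((\<Sum>j<Suc n. T j l) + R l) / (real n + 2))"
    by (intro sum_mono pointwise)
  also have "\<dots> = ((\<Sum>j<Suc n. \<Sum>l\<in>multi_indices N (Suc n). T j l) + (\<Sum>l\<in>multi_indices N (Suc n). R l)) / (real n + 2)"
    by (simp only: sum_divide_distrib[symmetric] sum.distrib sum.swap[of _ "{..<Suc n}"])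
  also have "\<dots> \<le> ((\<Sum>j<Suc n. 1) + 1) / (real n + 2)"
    by (intro divide_right_mono add_mono sum_mono sumT sumR) auto
  also have "\<dots> = 1" by simp
  finally show ?thesis .
qed

section \<open>A moment comparison for sums of fifth roots of unity\<close>


definition root5 :: complex where
  "root5 = cis (2 * pi / 5)"

lemma norm_root5_power [simp]: "cmod (root5 ^ r) = 1"
  by (simp add: root5_def norm_power)

lemma root5_power_5 [simp]: "root5 ^ 5 = 1"
proof -
  have "root5 ^ 5 = cis (real 5 * (2 * pi / 5))"
    unfolding root5_def by (rule Complex.DeMoivre)
  then show ?thesis by simp
qed

lemma root5_power_neq_1:
  assumes "0 < m" "m < 5"
  shows "root5 ^ m \<noteq> 1"
proof
  assume "root5 ^ m = 1"
  then have "cis (m * (2 * pi / 5)) = 1"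
    unfolding root5_def Complex.DeMoivre .
  then have "cos (2 * pi * m / 5) = 1"
    by (simp add: complex_eq_iff mult_ac)
  then obtain k :: int where "2 * pi * m / 5 = k * (2 * pi)"
    by (metis cos_one_2pi_int mult.assoc mult.commute)
  then have "real m = 5 * k" by (simp add: field_simps)
  then have "int m = 5 * k" by linarith
  then show False using assms by presburger
qed

lemma sum_root5_power:
  assumes "\<not> 5 dvd m"
  shows "(\<Sum>r<5. root5 ^ (m * r)) = 0"
proof -
  have "root5 ^ m = root5 ^ (m mod 5)"
    by (metis div_mult_mod_eq mult.commute power_add power_mult power_one root5_power_5 mult_1)
  then have "root5 ^ m \<noteq> 1"
    using root5_power_neq_1[of "m mod 5"] assms by (simp add: dvd_eq_mod_eq_0)
  moreover have "(root5 ^ m) ^ 5 = 1"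
    by (metis mult.commute power_mult power_one root5_power_5)
  ultimately show ?thesis
    by (simp add: power_mult geometric_sum)
qed

text \<open>
  Expanding \<open>t r = c * \<zeta> + cnj c * inverse \<zeta>\<close> with \<open>\<zeta> = root5 ^ r\<close>, only the constant terms survive the
  average, since exponents of absolute value at most four are divisible by five only when they
  vanish. A fourth moment is all that is needed below; this is why fifth roots suffice.
\<close>

lemma sum_root5_Re_powers:
  fixes c :: complex
  defines "t \<equiv> \<lambda>r. 2 * Re (c * root5 ^ r)"
  shows "(\<Sum>r<5. t r) = 0" "(\<Sum>r<5. (t r)\<^sup>2) = 10 * (cmod c)\<^sup>2"
    "(\<Sum>r<5. (t r) ^ 3) = 0" "(\<Sum>r<5. (t r) ^ 4) = 30 * (cmod c) ^ 4"
proof -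
  define d where "d = cnj c"
  have cd: "c * d = of_real ((cmod c)\<^sup>2)"
    by (simp add: d_def complex_mult_cnj cmod_power2)
  have cnj_root: "cnj (root5 ^ r) = root5 ^ (4 * r)" for r
  proof -
    have "cnj (root5 ^ r) * root5 ^ r = 1"
      using complex_norm_square[of "root5 ^ r"] by (simp add: mult.commute)
    moreover have "root5 ^ (4 * r) * root5 ^ r = (root5 ^ 5) ^ r"
      by (simp only: power_add[symmetric] power_mult[symmetric]) simp
    moreover have "root5 ^ r \<noteq> 0"
      using norm_root5_power[of r] by fastforce
    ultimately show ?thesis
      by (metis mult_cancel_right power_one root5_power_5)
  qed
  have t: "complex_of_real (t r) = c * root5 ^ r + d * root5 ^ (4 * r)" for r
    unfolding t_def d_def cnj_root[symmetric]
    by (simp only: complex_cnj_mult[symmetric] complex_add_cnj)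
  have pm: "root5 ^ (m * r) = (root5 ^ r) ^ m" for m r
    by (metis mult.commute power_mult)
  have one: "(\<Sum>r<5. root5 ^ (5 * r)) = 5" "(\<Sum>r<5. root5 ^ (10 * r)) = 5"
    using root5_power_5 power_mult[of root5 5 2] by (simp_all add: power_mult)
  have sum1: "(\<Sum>r<5. root5 ^ r) = 0"
    using sum_root5_power[of 1] by simp
  have "complex_of_real (\<Sum>r<5. t r) = c * (\<Sum>r<5. root5 ^ r) + d * (\<Sum>r<5. root5 ^ (4 * r))"
    by (simp add: t sum.distrib sum_distrib_left)
  then show "(\<Sum>r<5. t r) = 0"
    by (simp add: sum1 sum_root5_power del: of_real_sum)
  have "complex_of_real (\<Sum>r<5. (t r)\<^sup>2)
    = c\<^sup>2 * (\<Sum>r<5. root5 ^ (2 * r)) + 2 * (c * d) * (\<Sum>r<5. root5 ^ (5 * r)) + d\<^sup>2 * (\<Sum>r<5. root5 ^ (8 * r))"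
    unfolding sum_distrib_left sum.distrib[symmetric] of_real_sum
    by (intro sum.cong refl) (simp only: t pm of_real_power, simp add: eval_nat_numeral algebra_simps)
  also have "\<dots> = complex_of_real (10 * (cmod c)\<^sup>2)"
    by (simp add: sum_root5_power one cd)
  finally show "(\<Sum>r<5. (t r)\<^sup>2) = 10 * (cmod c)\<^sup>2"
    by (simp only: of_real_eq_iff)
  have "complex_of_real (\<Sum>r<5. (t r) ^ 3)
    = c ^ 3 * (\<Sum>r<5. root5 ^ (3 * r)) + 3 * (c\<^sup>2 * d) * (\<Sum>r<5. root5 ^ (6 * r))
      + 3 * (c * d\<^sup>2) * (\<Sum>r<5. root5 ^ (9 * r)) + d ^ 3 * (\<Sum>r<5. root5 ^ (12 * r))"
    unfolding sum_distrib_left sum.distrib[symmetric] of_real_sum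
    by (intro sum.cong refl) (simp only: t pm of_real_power, simp add: eval_nat_numeral algebra_simps)
  then show "(\<Sum>r<5. (t r) ^ 3) = 0"
    by (simp add: sum_root5_power del: of_real_sum)
  have "complex_of_real (\<Sum>r<5. (t r) ^ 4)
    = c ^ 4 * (\<Sum>r<5. root5 ^ (4 * r)) + 4 * (c ^ 3 * d) * (\<Sum>r<5. root5 ^ (7 * r))
      + 6 * (c * d)\<^sup>2 * (\<Sum>r<5. root5 ^ (10 * r)) + 4 * (c * d ^ 3) * (\<Sum>r<5. root5 ^ (13 * r))
      + d ^ 4 * (\<Sum>r<5. root5 ^ (16 * r))"
    unfolding sum_distrib_left sum.distrib[symmetric] of_real_sum
    by (intro sum.cong refl) (simp only: t pm of_real_power, simp add: eval_nat_numeral algebra_simps)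
  also have "\<dots> = complex_of_real (30 * (cmod c) ^ 4)"
    by (simp add: sum_root5_power one cd flip: power_mult)
  finally show "(\<Sum>r<5. (t r) ^ 4) = 30 * (cmod c) ^ 4"
    by (simp only: of_real_eq_iff)
qed

lemma cmod_add_power2: "(cmod (x + z))\<^sup>2 = (cmod x)\<^sup>2 + (cmod z)\<^sup>2 + 2 * Re (cnj x * z)"
  unfolding cmod_power2 by (simp add: power2_eq_square algebra_simps)

text \<open>
  In terms of \<open>w = sqrt x\<close> the difference of the two sides factors with double roots at \<open>w = 4 / 3\<close>
  and \<open>w = 2\<close>. Contact points near \<open>3 - sqrt 3\<close> and \<open>3 + sqrt 3\<close> for \<open>x\<close>, the Gauss quadrature nodes
  for the weight \<open>x * exp (- x)\<close>, would minimise the Gaussian expectation of the quartic;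
  \<open>16 / 9\<close> and \<open>4\<close> are close to the optimum under the positivity condition that the proof of
  \<open>gauss_quartic_root5_mean\<close> imposes on the coefficients.
\<close>

lemma three_halves_power_le_quartic:
  fixes x :: real
  assumes "x \<ge> 0"
  shows "16000 * x powr (3 / 2) \<le> 7936 * x + 9328 * x\<^sup>2 - 1152 * x ^ 3 + 81 * x ^ 4"
proof -
  define w where "w = sqrt x"
  have w: "w \<ge> 0" "x = w\<^sup>2" using assms by (simp_all add: w_def)
  have "x powr (3 / 2) = w ^ 3"
  proof (cases "w = 0")
    case False
    then have "w > 0" using w by simp
    then show ?thesis by (simp add: w powr_powr flip: powr_numeral)
  qed (simp add: w)
  moreover have "7936 * x + 9328 * x\<^sup>2 - 1152 * x ^ 3 + 81 * x ^ 4 - 16000 * w ^ 3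
    = w\<^sup>2 * (3 * w - 4)\<^sup>2 * (w - 2)\<^sup>2 * (9 * w\<^sup>2 + 60 * w + 124)"
    unfolding w(2) by (simp add: eval_nat_numeral algebra_simps)
  moreover have "\<dots> \<ge> 0" using w by simp
  ultimately show ?thesis by linarith
qed

text \<open>
  The expectation of \<open>7936 X + 9328 X\<^sup>2 - 1152 X^3 + 81 X^4\<close> for \<open>X = \<bar>y + sqrt v * G\<bar>\<^sup>2\<close>, where
  \<open>\<bar>y\<bar>\<^sup>2 = u\<close> and \<open>G\<close> is a standard complex Gaussian; the coefficient of \<open>u^(k-i) * v^i\<close> in the
  expectation of \<open>X^k\<close> is \<open>i! * (k choose i)\<^sup>2\<close>.
\<close>

definition gauss_quartic :: "real \<Rightarrow> real \<Rightarrow> real" where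
  "gauss_quartic v u = 7936 * (u + v) + 9328 * (u\<^sup>2 + 4 * u * v + 2 * v\<^sup>2)
     - 1152 * (u ^ 3 + 9 * u\<^sup>2 * v + 18 * u * v\<^sup>2 + 6 * v ^ 3)
     + 81 * (u ^ 4 + 16 * u ^ 3 * v + 72 * u\<^sup>2 * v\<^sup>2 + 96 * u * v ^ 3 + 24 * v ^ 4)"

text \<open>
  Replacing a Gaussian by a unimodular variable decreases every moment of \<open>X\<close> of order at
  least two, so the danger lies in the negative cubic coefficient; the gain \<open>D\<close> is a quadratic polynomial
  in the variances that stays positive because \<open>81 * 1152\<^sup>2 < 144 * 9328 * 81\<close>.
\<close>

lemma gauss_quartic_root5_mean:
  fixes y a :: complex
  assumes "v \<ge> 0"
  shows "(\<Sum>r<5. gauss_quartic v ((cmod (y + a * root5 ^ r))\<^sup>2))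
    \<le> 5 * gauss_quartic (v + (cmod a)\<^sup>2) ((cmod y)\<^sup>2)"
proof -
  define u s where "u = (cmod y)\<^sup>2" and "s = (cmod a)\<^sup>2"
  have us: "u \<ge> 0" "s \<ge> 0" by (simp_all add: u_def s_def)
  define c where "c = cnj y * a"
  define t where "t = (\<lambda>r. 2 * Re (c * root5 ^ r))"
  have c2: "(cmod c)\<^sup>2 = u * s" by (simp add: c_def u_def s_def norm_mult power_mult_distrib)
  have c4: "(cmod c) ^ 4 = (u * s)\<^sup>2" by (simp flip: c2 power_mult)
  have t_sums: "(\<Sum>r<5. t r) = 0" "(\<Sum>r<5. (t r)\<^sup>2) = 10 * (u * s)"
    "(\<Sum>r<5. (t r) ^ 3) = 0" "(\<Sum>r<5. (t r) ^ 4) = 30 * (u * s)\<^sup>2"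
    using sum_root5_Re_powers[of c] unfolding t_def c2 c4 by simp_all
  have expand: "(cmod (y + a * root5 ^ r))\<^sup>2 = u + s + t r" for r
    by (simp add: cmod_add_power2 t_def c_def u_def s_def norm_mult power_mult_distrib mult.assoc)
  define w where "w = u + s"
  define d1 where "d1 = 7936 + 9328 * (2 * w + 4 * v) - 1152 * (3 * w\<^sup>2 + 18 * w * v + 18 * v\<^sup>2)
       + 81 * (4 * w ^ 3 + 48 * w\<^sup>2 * v + 144 * w * v\<^sup>2 + 96 * v ^ 3)"
  define d2 where "d2 = 9328 - 1152 * (3 * w + 9 * v) + 81 * (6 * w\<^sup>2 + 48 * w * v + 72 * v\<^sup>2)"
  define d3 where "d3 = - 1152 + 81 * (4 * w + 16 * v)"
  have taylor: "gauss_quartic v (w + q)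
    = gauss_quartic v w + d1 * q + d2 * q\<^sup>2 + d3 * q ^ 3 + 81 * q ^ 4" for q
    unfolding gauss_quartic_def d1_def d2_def d3_def by (simp add: eval_nat_numeral algebra_simps)
  define S where "S = (\<Sum>r<5. gauss_quartic v ((cmod (y + a * root5 ^ r))\<^sup>2))"
  have "S = (\<Sum>r<5. gauss_quartic v (w + t r))"
    by (simp add: S_def expand w_def)
  also have "\<dots> = 5 * gauss_quartic v w + d2 * (10 * (u * s)) + 81 * (30 * (u * s)\<^sup>2)"
    unfolding taylor sum.distrib sum_distrib_left[symmetric] t_sums by simp
  finally have S_eq: "S = \<dots>" .
  \<comment> \<open>The mean of \<open>X^k\<close> has the coefficients \<open>(k choose i)\<^sup>2\<close> without the factor \<open>i!\<close>, so that the
    Gaussian and the unimodular step agree up to terms divisible by \<open>s\<^sup>2\<close>.\<close>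
  define D where "D = 9328 - 1152 * (9 * u + 5 * s + 9 * v)
      + 81 * (36 * u\<^sup>2 + 80 * u * s + 23 * s\<^sup>2 + 144 * u * v + 80 * v * s + 72 * v\<^sup>2)"
  have "5 * gauss_quartic (v + s) u - S = 5 * s\<^sup>2 * D"
    unfolding S_eq w_def gauss_quartic_def d2_def D_def by (simp add: eval_nat_numeral algebra_simps)
  moreover have "D \<ge> 0"
  proof -
    define z where "z = 9 * (u + v) + 5 * s"
    \<comment> \<open>The terms without \<open>z\<close> have nonnegative coefficients; completing the square handles the rest.\<close>
    have "D = 36 * (z - 16)\<^sup>2 + 112 + 81 * (40 * (u + v) * s + 107 / 9 * s\<^sup>2 + 72 * u * v + 36 * v\<^sup>2)"
      by (simp add: D_def z_def power2_eq_square algebra_simps)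
    then show ?thesis using us assms by simp
  qed
  then have "5 * s\<^sup>2 * D \<ge> 0" by simp
  ultimately have "S \<le> 5 * gauss_quartic (v + s) u"
    by linarith
  then show ?thesis by (simp add: S_def u_def s_def)
qed

lemma gauss_quartic_multi_root5_mean:
  fixes a :: "nat \<Rightarrow> complex"
  assumes "v \<ge> 0"
  shows "(\<Sum>e\<in>multi_indices 5 N. gauss_quartic v ((cmod (y + (\<Sum>k<N. a k * root5 ^ (e ! k))))\<^sup>2))
    \<le> 5 ^ N * gauss_quartic (v + (\<Sum>k<N. (cmod (a k))\<^sup>2)) ((cmod y)\<^sup>2)"
  using assms
proof (induction N arbitrary: v)
  case (Suc N)
  have split: "(\<Sum>k<Suc N. a k * root5 ^ ((e @ [r]) ! k)) = (\<Sum>k<N. a k * root5 ^ (e ! k)) + a N * root5 ^ r"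
    if "e \<in> multi_indices 5 N" for e r
    using that by (simp add: multi_indices_def nth_append)
  have "(\<Sum>e\<in>multi_indices 5 (Suc N). gauss_quartic v ((cmod (y + (\<Sum>k<Suc N. a k * root5 ^ (e ! k))))\<^sup>2))
    = (\<Sum>e\<in>multi_indices 5 N. \<Sum>r<5. gauss_quartic v ((cmod ((y + (\<Sum>k<N. a k * root5 ^ (e ! k))) + a N * root5 ^ r))\<^sup>2))"
    unfolding sum_multi_indices_snoc by (intro sum.cong refl) (simp add: split add.assoc del: sum.lessThan_Suc)
  also have "\<dots> \<le> (\<Sum>e\<in>multi_indices 5 N. 5 * gauss_quartic (v + (cmod (a N))\<^sup>2) ((cmod (y + (\<Sum>k<N. a k * root5 ^ (e ! k))))\<^sup>2))"
    by (intro sum_mono gauss_quartic_root5_mean Suc.prems)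
  also have "\<dots> \<le> 5 * (5 ^ N * gauss_quartic (v + (cmod (a N))\<^sup>2 + (\<Sum>k<N. (cmod (a k))\<^sup>2)) ((cmod y)\<^sup>2))"
    unfolding sum_distrib_left[symmetric] using Suc.prems by (intro mult_left_mono Suc.IH) auto
  finally show ?case by (simp add: algebra_simps)
qed simp

lemma sum_root5_second_moment:
  fixes a :: "nat \<Rightarrow> complex"
  shows "(\<Sum>e\<in>multi_indices 5 N. (cmod (y + (\<Sum>k<N. a k * root5 ^ (e ! k))))\<^sup>2)
    = 5 ^ N * ((cmod y)\<^sup>2 + (\<Sum>k<N. (cmod (a k))\<^sup>2))"
proof (induction N)
  case (Suc N)
  have split: "(\<Sum>k<Suc N. a k * root5 ^ ((e @ [r]) ! k)) = (\<Sum>k<N. a k * root5 ^ (e ! k)) + a N * root5 ^ r"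
    if "e \<in> multi_indices 5 N" for e r
    using that by (simp add: multi_indices_def nth_append)
  have mean: "(\<Sum>r<5. (cmod (x + b * root5 ^ r))\<^sup>2) = 5 * ((cmod x)\<^sup>2 + (cmod b)\<^sup>2)" for x b
  proof -
    have "(cmod (x + b * root5 ^ r))\<^sup>2 = (cmod x)\<^sup>2 + (cmod b)\<^sup>2 + 2 * Re (cnj x * b * root5 ^ r)" for r
      by (simp add: cmod_add_power2 norm_mult power_mult_distrib mult.assoc)
    then show ?thesis
      using sum_root5_Re_powers(1)[of "cnj x * b"] by (simp add: sum.distrib)
  qed
  have "(\<Sum>e\<in>multi_indices 5 (Suc N). (cmod (y + (\<Sum>k<Suc N. a k * root5 ^ (e ! k))))\<^sup>2)
    = (\<Sum>e\<in>multi_indices 5 N. \<Sum>r<5. (cmod ((y + (\<Sum>k<N. a k * root5 ^ (e ! k))) + a N * root5 ^ r))\<^sup>2)"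
    unfolding sum_multi_indices_snoc by (intro sum.cong refl) (simp add: split add.assoc del: sum.lessThan_Suc)
  also have "\<dots> = 5 * (\<Sum>e\<in>multi_indices 5 N. (cmod (y + (\<Sum>k<N. a k * root5 ^ (e ! k))))\<^sup>2 + (cmod (a N))\<^sup>2)"
    unfolding mean by (simp add: sum_distrib_left)
  also have "\<dots> = 5 * (5 ^ N * ((cmod y)\<^sup>2 + (\<Sum>k<N. (cmod (a k))\<^sup>2)) + 5 ^ N * (cmod (a N))\<^sup>2)"
    by (simp add: sum.distrib Suc.IH)
  finally show ?case by (simp add: algebra_simps)
qed simp

section \<open>A Khinchine inequality\<close>


text \<open>
  The Gaussian expectation \<open>gauss_quartic 1 0 / 16000\<close>, an upper bound for the third absolute moment of
  a normalised sum; the value for Gaussians is \<open>Gamma (5 / 2)\<close>, about \<open>1.3293\<close>.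
\<close>

definition khinchine_const :: real where
  "khinchine_const = 2703 / 2000"

lemma root5_moment_three_halves:
  fixes a :: "nat \<Rightarrow> complex"
  assumes "(\<Sum>k<N. (cmod (a k))\<^sup>2) = 1"
  shows "(\<Sum>e\<in>multi_indices 5 N. ((cmod (\<Sum>k<N. a k * root5 ^ (e ! k)))\<^sup>2) powr (3 / 2))
    \<le> 5 ^ N * khinchine_const"
proof -
  define X where "X = (\<lambda>e. (cmod (\<Sum>k<N. a k * root5 ^ (e ! k)))\<^sup>2)"
  have "16000 * (\<Sum>e\<in>multi_indices 5 N. X e powr (3 / 2)) \<le> (\<Sum>e\<in>multi_indices 5 N. gauss_quartic 0 (X e))"
    unfolding sum_distrib_left
  proof (rule sum_mono)
    fix e
    show "16000 * X e powr (3 / 2) \<le> gauss_quartic 0 (X e)"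
      using three_halves_power_le_quartic[of "X e"] by (simp add: gauss_quartic_def X_def)
  qed
  also have "\<dots> \<le> 5 ^ N * gauss_quartic 1 0"
    using gauss_quartic_multi_root5_mean[where v = 0 and y = 0 and N = N and a = a] assms by (simp add: X_def)
  also have "gauss_quartic 1 0 = 16000 * khinchine_const"
    by (simp add: gauss_quartic_def khinchine_const_def)
  finally show ?thesis by (simp add: X_def)
qed

text \<open>
  Interpolation of the first moment of \<open>X\<close> between the moments of orders \<open>s\<close> and \<open>3 / 2\<close>. In place of
  Hoelder's inequality the proof sums a pointwise Young inequality, whose scale \<open>\<tau>\<close> is chosen so that
  the term of order \<open>3 / 2\<close> contributes exactly its weight \<open>\<beta>\<close>.
\<close>

lemma khinchine_root5_normalized:
  fixes a :: "nat \<Rightarrow> complex" and s :: real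
  assumes s: "0 < s" "s < 1" and a: "(\<Sum>k<N. (cmod (a k))\<^sup>2) = 1"
  shows "5 ^ N \<le> khinchine_const powr (2 * (1 - s)) *
    (\<Sum>e\<in>multi_indices 5 N. ((cmod (\<Sum>k<N. a k * root5 ^ (e ! k)))\<^sup>2) powr s)"
proof -
  define M where "M = khinchine_const"
  have M: "M > 0" by (simp add: M_def khinchine_const_def)
  define X where "X = (\<lambda>e. (cmod (\<Sum>k<N. a k * root5 ^ (e ! k)))\<^sup>2)"
  have X: "X e \<ge> 0" for e by (simp add: X_def)
  define \<alpha> \<beta> where "\<alpha> = (1 / 2) / (3 / 2 - s)" and "\<beta> = (1 - s) / (3 / 2 - s)"
  have \<alpha>\<beta>: "\<alpha> > 0" "\<beta> \<ge> 0" "\<alpha> + \<beta> = 1" "s * \<alpha> + 3 / 2 * \<beta> = 1" "2 * (1 - s) * \<alpha> = \<beta>"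
  proof -
    have D: "3 / 2 - s > 0" using s by simp
    then show "\<alpha> > 0" "\<beta> \<ge> 0"
      using s by (simp_all add: \<alpha>_def \<beta>_def)
    have "2 * (1 - s) * (1 / 2) = 1 - s" by simp
    then show "2 * (1 - s) * \<alpha> = \<beta>"
      by (simp only: \<alpha>_def \<beta>_def times_divide_eq_right)
    have "\<alpha> + \<beta> = (1 / 2 + (1 - s)) / (3 / 2 - s)"
      unfolding \<alpha>_def \<beta>_def by (rule add_divide_distrib[symmetric])
    then show "\<alpha> + \<beta> = 1" using D by simp
    have "s * \<alpha> + 3 / 2 * \<beta> = (s * (1 / 2) + 3 / 2 * (1 - s)) / (3 / 2 - s)"
      unfolding \<alpha>_def \<beta>_def by (simp only: add_divide_distrib times_divide_eq_right)
    moreover have "s * (1 / 2) + 3 / 2 * (1 - s) = 3 / 2 - s" by (simp add: diff_divide_distrib right_diff_distrib)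
    ultimately show "s * \<alpha> + 3 / 2 * \<beta> = 1" using D by simp
  qed
  define \<tau> where "\<tau> = M powr (2 * (1 - s))"
  have \<tau>: "\<tau> > 0" using M by (simp add: \<tau>_def)
  have pointwise: "x \<le> \<alpha> * (\<tau> * x powr s) + \<beta> * (x powr (3 / 2) / M)" if "x \<ge> 0" for x
  proof (cases "x = 0")
    case False
    then have x: "x > 0" using that by simp
    have "(\<tau> * x powr s) powr \<alpha> * (x powr (3 / 2) / M) powr \<beta>
      = (\<tau> powr \<alpha> / M powr \<beta>) * (x powr (s * \<alpha>) * x powr (3 / 2 * \<beta>))"
      using x M \<tau> by (simp add: powr_mult powr_divide powr_powr)
    also have "\<tau> powr \<alpha> = M powr \<beta>"
      by (simp only: \<tau>_def powr_powr \<alpha>\<beta>(5))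
    also have "x powr (s * \<alpha>) * x powr (3 / 2 * \<beta>) = x"
      using x by (simp only: powr_add[symmetric] \<alpha>\<beta>(4)) simp
    finally have "x = (\<tau> * x powr s) powr \<alpha> * (x powr (3 / 2) / M) powr \<beta>"
      using M by simp
    also have "\<dots> \<le> \<alpha> * (\<tau> * x powr s) + \<beta> * (x powr (3 / 2) / M)"
      using x M \<tau> \<alpha>\<beta> by (intro Youngs_inequality_0) auto
    finally show ?thesis .
  qed simp
  have "5 ^ N = (\<Sum>e\<in>multi_indices 5 N. X e)"
    using sum_root5_second_moment[where y = 0 and N = N and a = a] a by (simp add: X_def)
  also have "\<dots> \<le> (\<Sum>e\<in>multi_indices 5 N. \<alpha> * (\<tau> * X e powr s) + \<beta> * (X e powr (3 / 2) / M))"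
    by (intro sum_mono pointwise X)
  also have "\<dots> = \<alpha> * (\<tau> * (\<Sum>e\<in>multi_indices 5 N. X e powr s))
      + \<beta> * ((\<Sum>e\<in>multi_indices 5 N. X e powr (3 / 2)) / M)"
    by (simp add: sum.distrib sum_distrib_left sum_divide_distrib)
  also have "\<dots> \<le> \<alpha> * (\<tau> * (\<Sum>e\<in>multi_indices 5 N. X e powr s)) + \<beta> * 5 ^ N"
    using root5_moment_three_halves[OF a] M \<alpha>\<beta>
    by (intro add_left_mono mult_left_mono) (auto simp: X_def M_def divide_le_eq)
  finally have "(1 - \<beta>) * 5 ^ N \<le> \<alpha> * (\<tau> * (\<Sum>e\<in>multi_indices 5 N. X e powr s))"
    by (simp add: algebra_simps)
  moreover have "1 - \<beta> = \<alpha>" using \<alpha>\<beta>(3) by simp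
  ultimately show ?thesis
    using \<alpha>\<beta>(1) by (simp add: X_def \<tau>_def M_def)
qed

lemma khinchine_root5:
  fixes a :: "nat \<Rightarrow> complex" and s :: real
  assumes s: "0 < s" "s < 1"
  shows "5 ^ N * (\<Sum>k<N. (cmod (a k))\<^sup>2) powr s \<le> khinchine_const powr (2 * (1 - s)) *
    (\<Sum>e\<in>multi_indices 5 N. ((cmod (\<Sum>k<N. a k * root5 ^ (e ! k)))\<^sup>2) powr s)"
proof -
  define V where "V = (\<Sum>k<N. (cmod (a k))\<^sup>2)"
  have "V \<ge> 0" by (simp add: V_def sum_nonneg)
  show ?thesis
  proof (cases "V = 0")
    case True
    then show ?thesis by (simp add: V_def sum_nonneg)
  next
    case False
    with \<open>V \<ge> 0\<close> have V: "V > 0" by simp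
    define b where "b = (\<lambda>k. a k / of_real (sqrt V))"
    have "(\<Sum>k<N. (cmod (b k))\<^sup>2) = (\<Sum>k<N. (cmod (a k))\<^sup>2 / V)"
      using V by (simp add: b_def norm_divide power_divide)
    also have "\<dots> = 1"
      using V by (simp add: V_def[symmetric] flip: sum_divide_distrib)
    finally have b: "(\<Sum>k<N. (cmod (b k))\<^sup>2) = 1" .
    have scale: "((cmod (\<Sum>k<N. b k * root5 ^ (e ! k)))\<^sup>2) powr s
      = ((cmod (\<Sum>k<N. a k * root5 ^ (e ! k)))\<^sup>2) powr s / V powr s" for e
    proof -
      have "(\<Sum>k<N. b k * root5 ^ (e ! k)) = (\<Sum>k<N. a k * root5 ^ (e ! k)) / of_real (sqrt V)"
        by (simp add: b_def sum_divide_distrib)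
      then show ?thesis
        using V by (simp add: norm_divide power_divide powr_divide)
    qed
    from khinchine_root5_normalized[OF s b] V show ?thesis
      unfolding scale V_def[symmetric] by (simp add: field_simps flip: sum_divide_distrib)
  qed
qed

section \<open>Multilinear forms on the polydisc\<close>


definition polydisc_norm :: "nat \<Rightarrow> nat \<Rightarrow> (complex Matrix.vec list \<Rightarrow> complex) \<Rightarrow> real" where
  "polydisc_norm n N U = (SUP zs \<in> {zs. length zs = n \<and> set zs \<subseteq> polydisc N}. cmod (U zs))"

lemma BH_admissible_alt:
  "BH_admissible n C \<longleftrightarrow> 1 \<le> C \<and> (\<forall>N\<ge>1. \<forall>U. multilinear_form n N U \<longrightarrow>
     (\<Sum>is\<in>multi_indices N n. cmod (U (map (unit_vec N) is)) powr (2 * real n / (real n + 1)))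
       powr ((real n + 1) / (2 * real n)) \<le> C * polydisc_norm n N U)"
  by (simp add: BH_admissible_def polydisc_norm_def multi_indices_def)

lemma
  assumes "multilinear_form (Suc n) N U" "length l = n" "set l \<subseteq> carrier_vec N" "j \<le> n"
    "x \<in> carrier_vec N" "y \<in> carrier_vec N"
  shows multilinear_form_add: "U (insert_at j (x + y) l) = U (insert_at j x l) + U (insert_at j y l)"
    and multilinear_form_smult: "U (insert_at j (c \<cdot>\<^sub>v x) l) = c * U (insert_at j x l)"
proof -
  have "U ((insert_at j x l)[j := x + y]) = U ((insert_at j x l)[j := x]) + U ((insert_at j x l)[j := y]) \<and>
      U ((insert_at j x l)[j := c \<cdot>\<^sub>v x]) = c * U ((insert_at j x l)[j := x])"
    using assms(1)[unfolded multilinear_form_def, rule_format, of "insert_at j x l" j x y c] assms(2-)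
    by simp
  then show "U (insert_at j (x + y) l) = U (insert_at j x l) + U (insert_at j y l)"
    "U (insert_at j (c \<cdot>\<^sub>v x) l) = c * U (insert_at j x l)"
    using assms(2,4) by (simp_all add: insert_at_update_same)
qed

lemma multilinear_form_expand:
  assumes U: "multilinear_form (Suc n) N U" and l: "length l = n" "set l \<subseteq> carrier_vec N"
    and j: "j \<le> n" and z: "z \<in> carrier_vec N"
  shows "U (insert_at j z l) = (\<Sum>k<N. vec_index z k * U (insert_at j (unit_vec N k) l))"
proof -
  note add = multilinear_form_add[OF U l j] and smult = multilinear_form_smult[OF U l j]
  define w where "w = (\<lambda>K. vec N (\<lambda>i. if i < K then vec_index z i else 0))"
  have w_carrier: "w K \<in> carrier_vec N" for K by (simp add: w_def)
  have "U (insert_at j (w K) l) = (\<Sum>k<K. vec_index z k * U (insert_at j (unit_vec N k) l))" if "K \<le> N" for K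
    using that
  proof (induction K)
    case 0
    have "w 0 = 0 \<cdot>\<^sub>v z" using z by (auto simp: w_def)
    then show ?case using smult[OF z z, of 0] by simp
  next
    case (Suc K)
    have "w (Suc K) = w K + vec_index z K \<cdot>\<^sub>v unit_vec N K"
      using Suc.prems by (auto simp: w_def less_Suc_eq)
    then show ?case
      using Suc add[OF w_carrier, of "vec_index z K \<cdot>\<^sub>v unit_vec N K" K] smult[of "unit_vec N K" "unit_vec N K" "vec_index z K"]
      by simp
  qed
  moreover have "w N = z" using z by (auto simp: w_def)
  ultimately show ?thesis by (metis order_refl)
qed

lemma multilinear_form_fix:
  assumes U: "multilinear_form (Suc n) N U" and j: "j \<le> n" and z: "z \<in> carrier_vec N"
  shows "multilinear_form n N (\<lambda>l. U (insert_at j z l))"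
  unfolding multilinear_form_def
proof (intro allI impI)
  fix zs :: "complex Matrix.vec list" and i and x y :: "complex Matrix.vec" and c
  assume a: "length zs = n" "set zs \<subseteq> carrier_vec N" "i < n" "x \<in> carrier_vec N" "y \<in> carrier_vec N"
  have "(if i < j then i else Suc i) < Suc n" "length (insert_at j z zs) = Suc n"
    "set (insert_at j z zs) \<subseteq> carrier_vec N"
    using a z by auto
  from U[unfolded multilinear_form_def, rule_format, OF this(2,3,1) a(4,5)]
  show "U (insert_at j z (zs[i := x + y])) = U (insert_at j z (zs[i := x])) + U (insert_at j z (zs[i := y])) \<and>
        U (insert_at j z (zs[i := c \<cdot>\<^sub>v x])) = c * U (insert_at j z (zs[i := x]))"
    using j a(1,3) by (simp only: insert_at_update)
qed

text \<open>
  A real supremum is specified only for bounded sets. Expanding the first slot in unit vectors reduces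
  the number of slots, and the coordinates of points of the polydisc are at most one in modulus.
\<close>

lemma multilinear_form_bounded:
  assumes "multilinear_form n N U"
  shows "\<exists>B. \<forall>zs. length zs = n \<longrightarrow> set zs \<subseteq> polydisc N \<longrightarrow> cmod (U zs) \<le> B"
  using assms
proof (induction n arbitrary: U)
  case (Suc n)
  have "\<forall>k. \<exists>B. \<forall>zs. length zs = n \<longrightarrow> set zs \<subseteq> polydisc N \<longrightarrow> cmod (U (insert_at 0 (unit_vec N k) zs)) \<le> B"
    using Suc.IH multilinear_form_fix[OF Suc.prems] by (metis unit_vec_carrier zero_le)
  then obtain B where B: "\<And>k zs. \<lbrakk>length zs = n; set zs \<subseteq> polydisc N\<rbrakk> \<Longrightarrow>
      cmod (U (insert_at 0 (unit_vec N k) zs)) \<le> B k"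
    by metis
  have "cmod (U zs) \<le> (\<Sum>k<N. B k)" if zs: "length zs = Suc n" "set zs \<subseteq> polydisc N" for zs
  proof -
    obtain z l where zl: "zs = insert_at 0 z l" "length l = n"
      using zs(1) by (cases zs) (auto simp: insert_at_def)
    have z: "z \<in> polydisc N" and l: "set l \<subseteq> polydisc N" using zs(2) zl(1) by auto
    have "cmod (U zs) = cmod (\<Sum>k<N. vec_index z k * U (insert_at 0 (unit_vec N k) l))"
      unfolding zl(1) using z l
      by (subst multilinear_form_expand[OF Suc.prems zl(2)]) (auto simp: polydisc_def)
    also have "\<dots> \<le> (\<Sum>k<N. 1 * B k)"
    proof (rule sum_norm_le)
      fix k assume "k \<in> {..<N}"
      then have "cmod (vec_index z k) \<le> 1" using z by (auto simp: polydisc_def less_imp_le)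
      then show "cmod (vec_index z k * U (insert_at 0 (unit_vec N k) l)) \<le> 1 * B k"
        unfolding norm_mult using B[OF zl(2) l] by (intro mult_mono) auto
    qed
    finally show ?thesis by simp
  qed
  then show ?case by blast
qed auto

lemma polydisc_norm_upper:
  assumes "multilinear_form n N U" "length zs = n" "set zs \<subseteq> polydisc N"
  shows "cmod (U zs) \<le> polydisc_norm n N U"
  unfolding polydisc_norm_def
proof (rule cSUP_upper)
  show "bdd_above ((\<lambda>zs. cmod (U zs)) ` {zs. length zs = n \<and> set zs \<subseteq> polydisc N})"
    using multilinear_form_bounded[OF assms(1)] by (auto simp: bdd_above_def)
qed (use assms in auto)

lemma zero_in_polydisc: "0\<^sub>v N \<in> polydisc N"
  by (simp add: polydisc_def)

lemma polydisc_norm_least: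
  assumes "\<And>zs. \<lbrakk>length zs = n; set zs \<subseteq> polydisc N\<rbrakk> \<Longrightarrow> cmod (U zs) \<le> B"
  shows "polydisc_norm n N U \<le> B"
  unfolding polydisc_norm_def
proof (rule cSUP_least)
  have "replicate n (0\<^sub>v N) \<in> {zs. length zs = n \<and> set zs \<subseteq> polydisc N}"
    using zero_in_polydisc by auto
  then show "{zs. length zs = n \<and> set zs \<subseteq> polydisc N} \<noteq> {}" by blast
qed (use assms in auto)

lemma polydisc_norm_nonneg:
  assumes "multilinear_form n N U"
  shows "0 \<le> polydisc_norm n N U"
proof -
  have "set (replicate n (0\<^sub>v N)) \<subseteq> polydisc N"
    using zero_in_polydisc by auto
  then have "cmod (U (replicate n (0\<^sub>v N))) \<le> polydisc_norm n N U"
    using assms by (intro polydisc_norm_upper) auto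
  then show ?thesis using norm_ge_zero order_trans by blast
qed

text \<open>
  Random unimodular coordinates lie on the boundary of the polydisc; they are reached by scaling a
  single slot with \<open>r < 1\<close>, which scales the value of the form by \<open>r\<close>.
\<close>

lemma polydisc_norm_upper_closed_slot:
  assumes U: "multilinear_form (Suc n) N U" and j: "j \<le> n"
    and z: "z \<in> carrier_vec N" "\<And>k. k < N \<Longrightarrow> cmod (vec_index z k) \<le> 1"
    and l: "length l = n" "set l \<subseteq> polydisc N"
  shows "cmod (U (insert_at j z l)) \<le> polydisc_norm (Suc n) N U"
proof (rule field_le_mult_one_interval)
  fix r :: real assume r: "0 < r" "r < 1"
  have "cmod (complex_of_real r * vec_index z k) < 1" if "k < N" for k
  proof -
    have "r * cmod (vec_index z k) \<le> r * 1"
      using z(2)[OF that] r by (intro mult_left_mono) auto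
    then have "r * cmod (vec_index z k) < 1" using r by linarith
    then show ?thesis using r by (simp add: norm_mult)
  qed
  then have rz: "complex_of_real r \<cdot>\<^sub>v z \<in> polydisc N"
    using z(1) by (auto simp: polydisc_def)
  have "set l \<subseteq> carrier_vec N" using l(2) by (auto simp: polydisc_def)
  then have "r * cmod (U (insert_at j z l)) = cmod (U (insert_at j (complex_of_real r \<cdot>\<^sub>v z) l))"
    using multilinear_form_smult[OF U l(1) _ j z(1) z(1)] r by (simp add: norm_mult)
  also have "\<dots> \<le> polydisc_norm (Suc n) N U"
    using polydisc_norm_upper[OF U, of "insert_at j (complex_of_real r \<cdot>\<^sub>v z) l"] rz l by simp
  finally show "r * cmod (U (insert_at j z l)) \<le> polydisc_norm (Suc n) N U" .
qed

lemma polydisc_norm_fix_le: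
  assumes "multilinear_form (Suc n) N U" "j \<le> n"
    and "z \<in> carrier_vec N" "\<And>k. k < N \<Longrightarrow> cmod (vec_index z k) \<le> 1"
  shows "polydisc_norm n N (\<lambda>l. U (insert_at j z l)) \<le> polydisc_norm (Suc n) N U"
  by (intro polydisc_norm_least polydisc_norm_upper_closed_slot assms)

text \<open>
  For a linear functional the exponent is \<open>1\<close>, and choosing the phases of the coordinates conjugate
  to those of the coefficients attains the \<open>\<ell>\<^sub>1\<close>-norm.
\<close>

lemma BH_admissible_1: "BH_admissible 1 1"
  unfolding BH_admissible_alt
proof (intro conjI allI impI)
  fix N U assume U: "multilinear_form 1 N U"
  define u where "u = (\<lambda>k. U [unit_vec N k])"
  define z where "z = vec N (\<lambda>k. cnj (sgn (u k)))"
  have zk: "vec_index z k * u k = of_real (cmod (u k))" if "k < N" for k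
  proof (cases "u k = 0")
    case False
    have "cnj (u k) * u k = of_real (cmod (u k)) * of_real (cmod (u k))"
      using complex_norm_square[of "u k"] by (simp add: power2_eq_square mult.commute)
    then show ?thesis
      using that False by (simp add: z_def sgn_eq field_simps)
  qed (use that in \<open>simp add: z_def\<close>)
  have z: "z \<in> carrier_vec N" "\<And>k. k < N \<Longrightarrow> cmod (vec_index z k) \<le> 1"
    by (auto simp: z_def norm_sgn)
  have "U [z] = (\<Sum>k<N. vec_index z k * u k)"
    using multilinear_form_expand[of 0 N U "[]" 0 z] U z(1) by (simp add: insert_at_def u_def)
  also have "\<dots> = of_real (\<Sum>k<N. cmod (u k))"
    by (simp add: zk)
  finally have "(\<Sum>k<N. cmod (u k)) = cmod (U [z])"
    by (simp add: sum_nonneg del: of_real_sum)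
  also have "\<dots> \<le> polydisc_norm 1 N U"
    using polydisc_norm_upper_closed_slot[of 0 N U 0 z "[]"] U z by (simp add: insert_at_def)
  finally show "(\<Sum>is\<in>multi_indices N 1. cmod (U (map (unit_vec N) is)) powr (2 * real 1 / (real 1 + 1)))
      powr ((real 1 + 1) / (2 * real 1)) \<le> 1 * polydisc_norm 1 N U"
    using sum_multi_indices_insert[of 0 0 "\<lambda>is. cmod (U (map (unit_vec N) is))" N]
    by (simp add: insert_at_def u_def sum_nonneg)
qed simp

section \<open>The inductive step\<close>

text \<open>
  Homogeneity reduces this to \<open>blei_normalized\<close>; dividing by some \<open>D > B\<close> rather than by \<open>B\<close> covers
  \<open>B = 0\<close> as well.
\<close>

lemma blei:
  fixes a :: "nat list \<Rightarrow> real"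
  assumes n: "n \<ge> 1" and a: "\<And>l. 0 \<le> a l" and B: "B \<ge> 0"
    and g_le: "\<And>j. j \<le> n \<Longrightarrow> (\<Sum>l\<in>multi_indices N n.
        (\<Sum>x<N. (a (insert_at j x l))\<^sup>2) powr (real n / (real n + 1))) \<le> B powr (2 * real n / (real n + 1))"
  shows "(\<Sum>l\<in>multi_indices N (Suc n). a l powr (2 * (real n + 1) / (real n + 2))) powr ((real n + 2) / (2 * (real n + 1))) \<le> B"
proof (rule dense_ge)
  fix D assume "B < D"
  then have D: "D > 0" using B by simp
  define b where "b = (\<lambda>l. a l / D)"
  have "(\<Sum>l\<in>multi_indices N (Suc n). b l powr (2 * (real n + 1) / (real n + 2))) \<le> 1"
  proof (rule blei_normalized[OF n])
    fix j assume j: "j \<le> n"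
    have "sqrt (\<Sum>x<N. (b (insert_at j x l))\<^sup>2) powr (2 * real n / (real n + 1))
      = (\<Sum>x<N. (a (insert_at j x l))\<^sup>2) powr (real n / (real n + 1)) / D powr (2 * real n / (real n + 1))" for l
    proof -
      have nn: "(\<Sum>x<N. (a (insert_at j x l))\<^sup>2) \<ge> 0" by (simp add: sum_nonneg)
      have "sqrt (\<Sum>x<N. (b (insert_at j x l))\<^sup>2) = sqrt (\<Sum>x<N. (a (insert_at j x l))\<^sup>2) / D"
        using D by (simp add: b_def power_divide real_sqrt_divide flip: sum_divide_distrib)
      also have "sqrt (\<Sum>x<N. (a (insert_at j x l))\<^sup>2) = (\<Sum>x<N. (a (insert_at j x l))\<^sup>2) powr (1 / 2)"
        using nn by (simp add: powr_half_sqrt)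
      finally show ?thesis
        using nn D by (simp add: powr_divide powr_powr)
    qed
    then have "(\<Sum>l\<in>multi_indices N n. sqrt (\<Sum>x<N. (b (insert_at j x l))\<^sup>2) powr (2 * real n / (real n + 1)))
      = (\<Sum>l\<in>multi_indices N n. (\<Sum>x<N. (a (insert_at j x l))\<^sup>2) powr (real n / (real n + 1))) / D powr (2 * real n / (real n + 1))"
      by (simp add: sum_divide_distrib)
    also have "\<dots> \<le> B powr (2 * real n / (real n + 1)) / D powr (2 * real n / (real n + 1))"
      by (intro divide_right_mono g_le j) simp
    also have "\<dots> \<le> 1"
      using B \<open>B < D\<close> D by (simp add: divide_le_eq powr_mono2)
    finally show "(\<Sum>l\<in>multi_indices N n. sqrt (\<Sum>x<N. (b (insert_at j x l))\<^sup>2) powr (2 * real n / (real n + 1))) \<le> 1" .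
  qed (use a D in \<open>auto simp: b_def\<close>)
  moreover have "b l powr (2 * (real n + 1) / (real n + 2)) = a l powr (2 * (real n + 1) / (real n + 2)) / D powr (2 * (real n + 1) / (real n + 2))" for l
    using a[of l] D by (simp add: b_def powr_divide)
  ultimately have "(\<Sum>l\<in>multi_indices N (Suc n). a l powr (2 * (real n + 1) / (real n + 2))) \<le> D powr (2 * (real n + 1) / (real n + 2))"
    using D by (simp add: divide_le_eq flip: sum_divide_distrib)
  then have "(\<Sum>l\<in>multi_indices N (Suc n). a l powr (2 * (real n + 1) / (real n + 2))) powr ((real n + 2) / (2 * (real n + 1)))
    \<le> (D powr (2 * (real n + 1) / (real n + 2))) powr ((real n + 2) / (2 * (real n + 1)))"
    by (intro powr_mono2) (auto intro: sum_nonneg)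
  also have "\<dots> = D"
    using D by (simp add: powr_powr)
  finally show "(\<Sum>l\<in>multi_indices N (Suc n). a l powr (2 * (real n + 1) / (real n + 2))) powr ((real n + 2) / (2 * (real n + 1))) \<le> D" .
qed

text \<open>
  The constant appears with power \<open>1 / n\<close> because the Khinchine inequality for \<open>s = n / (n + 1)\<close> costs
  \<open>M powr (2 * (1 - s))\<close> on the level of \<open>p\<close>-th powers, \<open>p = 2 * s\<close>, and \<open>2 * (1 - s) / p = 1 / n\<close>.
\<close>

lemma BH_admissible_Suc:
  assumes n: "n \<ge> 1" and C: "BH_admissible n C"
  shows "BH_admissible (Suc n) (khinchine_const powr (1 / real n) * C)"
  unfolding BH_admissible_alt
proof (intro conjI allI impI)
  have C1: "C \<ge> 1" using C by (simp add: BH_admissible_alt)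
  have M: "khinchine_const powr (1 / real n) \<ge> 1"
    by (simp add: ge_one_powr_ge_zero khinchine_const_def)
  show "1 \<le> khinchine_const powr (1 / real n) * C"
    using mult_mono[OF M C1] by simp
  fix N :: nat and U assume N: "N \<ge> 1" and U: "multilinear_form (Suc n) N U"
  define S where "S = polydisc_norm (Suc n) N U"
  have S: "S \<ge> 0" using polydisc_norm_nonneg[OF U] by (simp add: S_def)
  define s p where "s = real n / (real n + 1)" and "p = 2 * real n / (real n + 1)"
  have s: "0 < s" "s < 1" and p: "p = 2 * s" "p > 0"
    using n by (simp_all add: s_def p_def)
  define a where "a = (\<lambda>is. cmod (U (map (unit_vec N) is)))"
  define z where "z = (\<lambda>e. vec N (\<lambda>k. root5 ^ (e ! k)))"
  have z: "z e \<in> carrier_vec N" "k < N \<Longrightarrow> cmod (vec_index (z e) k) \<le> 1" for e k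
    by (simp_all add: z_def)
  define V where "V = (\<lambda>j e l. cmod (U (insert_at j (z e) (map (unit_vec N) l))))"
  \<comment> \<open>\<open>V j e l\<close> has the sign pattern \<open>e\<close> of fifth roots in slot \<open>j\<close>; for fixed \<open>e\<close> the
    \<open>n\<close>-linear inequality applies, and for fixed \<open>l\<close> the average over \<open>e\<close> is a Khinchine sum.\<close>
  have V_le: "(\<Sum>l\<in>multi_indices N n. V j e l powr p) \<le> (C * S) powr p" if j: "j \<le> n" for j e
  proof -
    define T where "T = (\<Sum>l\<in>multi_indices N n. V j e l powr p)"
    have "T \<ge> 0" by (simp add: T_def sum_nonneg)
    have "T powr ((real n + 1) / (2 * real n)) \<le> C * polydisc_norm n N (\<lambda>l. U (insert_at j (z e) l))"
      unfolding T_def V_def p_def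
      using C[unfolded BH_admissible_alt, THEN conjunct2, rule_format, OF N multilinear_form_fix[OF U j z(1)]] .
    then have "T powr (1 / p) \<le> C * polydisc_norm n N (\<lambda>l. U (insert_at j (z e) l))"
      by (simp add: p_def)
    also have "\<dots> \<le> C * S"
      unfolding S_def using C1 j by (intro mult_left_mono polydisc_norm_fix_le U z) auto
    finally have "(T powr (1 / p)) powr p \<le> (C * S) powr p"
      using p by (intro powr_mono2) auto
    then show ?thesis
      using \<open>T \<ge> 0\<close> p by (simp add: powr_powr T_def)
  qed
  have "(\<Sum>l\<in>multi_indices N (Suc n). a l powr (2 * (real n + 1) / (real n + 2))) powr ((real n + 2) / (2 * (real n + 1)))
      \<le> khinchine_const powr (1 / real n) * C * S"
  proof (rule blei[OF n])
    fix j assume j: "j \<le> n"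
    define K where "K = khinchine_const powr (2 * (1 - s))"
    have slot: "5 ^ N * (\<Sum>x<N. (a (insert_at j x l))\<^sup>2) powr s \<le> K * (\<Sum>e\<in>multi_indices 5 N. V j e l powr p)"
      if l: "l \<in> multi_indices N n" for l
    proof -
      have car: "length (map (unit_vec N) l) = n" "set (map (unit_vec N) l) \<subseteq> carrier_vec N"
        using l by (auto simp: multi_indices_def)
      define c where "c = (\<lambda>x. U (insert_at j (unit_vec N x) (map (unit_vec N) l)))"
      have "((cmod (\<Sum>k<N. c k * root5 ^ (e ! k)))\<^sup>2) powr s = V j e l powr p" for e
      proof -
        have "(\<Sum>k<N. c k * root5 ^ (e ! k)) = U (insert_at j (z e) (map (unit_vec N) l))"
          using multilinear_form_expand[OF U car j z(1)[of e]]
          by (simp add: c_def z_def mult.commute)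
        then show ?thesis
          by (simp add: V_def p powr_powr[symmetric] powr_numeral)
      qed
      then show ?thesis
        using khinchine_root5[OF s, of N c] by (simp add: K_def a_def c_def map_insert_at)
    qed
    have "5 ^ N * (\<Sum>l\<in>multi_indices N n. (\<Sum>x<N. (a (insert_at j x l))\<^sup>2) powr s)
      \<le> (\<Sum>l\<in>multi_indices N n. K * (\<Sum>e\<in>multi_indices 5 N. V j e l powr p))"
      unfolding sum_distrib_left by (intro sum_mono) (use slot in \<open>simp add: sum_distrib_left\<close>)
    also have "\<dots> = K * (\<Sum>e\<in>multi_indices 5 N. \<Sum>l\<in>multi_indices N n. V j e l powr p)"
      by (subst sum.swap) (simp add: sum_distrib_left)
    also have "\<dots> \<le> K * (\<Sum>e\<in>multi_indices 5 N. (C * S) powr p)"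
      using j by (intro mult_left_mono sum_mono V_le) (auto simp: K_def)
    also have "\<dots> = 5 ^ N * (K * (C * S) powr p)"
      by simp
    finally have "(\<Sum>l\<in>multi_indices N n. (\<Sum>x<N. (a (insert_at j x l))\<^sup>2) powr s) \<le> K * (C * S) powr p"
      by simp
    also have "\<dots> = (khinchine_const powr (1 / real n) * C * S) powr p"
    proof -
      have "2 * (1 - s) = (1 / real n) * p"
        using n by (simp add: s_def p_def field_simps)
      then show ?thesis
        using C1 S by (simp add: K_def powr_mult powr_powr mult.assoc)
    qed
    finally show "(\<Sum>l\<in>multi_indices N n. (\<Sum>x<N. (a (insert_at j x l))\<^sup>2) powr (real n / (real n + 1)))
        \<le> (khinchine_const powr (1 / real n) * C * S) powr (2 * real n / (real n + 1))"
      by (simp add: s_def p_def add.commute)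
  qed (use C1 S M in \<open>auto simp: a_def\<close>)
  then show "(\<Sum>is\<in>multi_indices N (Suc n). cmod (U (map (unit_vec N) is)) powr (2 * real (Suc n) / (real (Suc n) + 1)))
      powr ((real (Suc n) + 1) / (2 * real (Suc n))) \<le> khinchine_const powr (1 / real n) * C * polydisc_norm (Suc n) N U"
    by (simp add: a_def S_def add.commute)
qed

section \<open>The constants and their numerical bounds\<close>


text \<open>
  \<open>LEAST\<close> over the reals is specified only if the minimum is attained. It is, since every
  instance of the inequality is a closed condition on the constant.
\<close>

lemma BH_const_le:
  assumes C: "BH_admissible n C"
  shows "BH_const n \<le> C"
proof -
  define A where "A = {C. BH_admissible n C}"
  have A: "C \<in> A" "bdd_below A"
    using C by (auto simp: A_def BH_admissible_def intro: bdd_belowI[of _ 1])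
  have "BH_admissible n (Inf A)"
    unfolding BH_admissible_alt
  proof (intro conjI allI impI)
    show "1 \<le> Inf A"
      using A by (intro cInf_greatest) (auto simp: A_def BH_admissible_def)
    fix N :: nat and U assume N: "N \<ge> 1" and U: "multilinear_form n N U"
    define L where "L = (\<Sum>is\<in>multi_indices N n. cmod (U (map (unit_vec N) is)) powr (2 * real n / (real n + 1)))
       powr ((real n + 1) / (2 * real n))"
    define S where "S = polydisc_norm n N U"
    have S: "S \<ge> 0" using polydisc_norm_nonneg[OF U] by (simp add: S_def)
    have LC: "L \<le> C * S" if "C \<in> A" for C
      using that N U by (simp add: A_def BH_admissible_alt L_def S_def)
    have "L \<le> Inf A * S"
    proof (cases "S = 0")
      case True
      then show ?thesis using LC[OF A(1)] by simp
    next
      case False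
      with S have "S > 0" by simp
      have "L / S \<le> Inf A"
        using A LC \<open>S > 0\<close> by (intro cInf_greatest) (auto simp: divide_le_eq)
      then show ?thesis using \<open>S > 0\<close> by (simp add: divide_le_eq)
    qed
    then show "(\<Sum>is\<in>multi_indices N n. cmod (U (map (unit_vec N) is)) powr (2 * real n / (real n + 1)))
       powr ((real n + 1) / (2 * real n)) \<le> Inf A * polydisc_norm n N U"
      by (simp add: L_def S_def)
  qed
  then have "BH_const n = Inf A"
    unfolding BH_const_def by (rule Least_equality) (use A in \<open>auto simp: A_def intro: cInf_lower\<close>)
  then show ?thesis using A by (simp add: cInf_lower)
qed

lemma BH_admissible_harm: "BH_admissible (Suc n) (khinchine_const powr harm n)"
proof (induction n)
  case 0
  then show ?case using BH_admissible_1 by (simp add: harm_def khinchine_const_def)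
next
  case (Suc n)
  have "khinchine_const powr harm (Suc n) = khinchine_const powr (1 / real (Suc n)) * khinchine_const powr harm n"
    by (simp add: harm_Suc powr_add inverse_eq_divide mult.commute)
  then show ?case using BH_admissible_Suc[OF _ Suc] by simp
qed

lemma harm_le_one_plus_ln:
  assumes "n \<ge> 1"
  shows "harm n \<le> 1 + ln (real n)"
  using euler_mascheroni_sequence_decreasing[of 1 n] assms by (simp add: harm_def)

lemma ln_khinchine_const: "0 < ln khinchine_const" "ln khinchine_const \<le> 302 / 1000"
proof -
  show "0 < ln khinchine_const" by (simp add: khinchine_const_def)
  have "khinchine_const \<le> 1 + 302 / 1000 + (302 / 1000)\<^sup>2 / 2 + (302 / 1000) ^ 3 / 6"
    by (simp add: khinchine_const_def power2_eq_square power3_eq_cube)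
  also have "\<dots> = (\<Sum>k<4. (302 / 1000 :: real) ^ k / fact k)"
    by (simp add: eval_nat_numeral fact_numeral)
  also have "\<dots> \<le> exp (302 / 1000)"
    using summable_exp_generic[of "302 / 1000 :: real"] unfolding exp_def
    by (simp only: scaleR_conv_of_real of_real_eq_id id_apply divide_inverse mult.commute[of "_ ^ _"])
       (intro sum_le_suminf, auto)
  finally show "ln khinchine_const \<le> 302 / 1000"
    using ln_mono[of khinchine_const "exp (302 / 1000)"] by (simp add: khinchine_const_def)
qed

text \<open>
  The increment of the convex exponential is at most its derivative at the right end, \<open>c / m\<close> times
  the larger value; \<open>harm m \<le> 1 + ln m\<close> turns that value into \<open>M * m powr c\<close>.
  The numbers enter through \<open>ln M \<le> 0.302\<close> and \<open>M * 0.302 \<le> 0.409\<close>.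
\<close>

lemma khinchine_const_powr_harm_increment:
  "khinchine_const powr harm (Suc j) - khinchine_const powr harm j
    \<le> 409 / 1000 * real (Suc j) powr (302 / 1000 - 1)"
proof -
  define M c where "M = khinchine_const" and "c = ln M"
  have M: "M > 0" by (simp add: M_def khinchine_const_def)
  have c: "0 < c" "c \<le> 302 / 1000" using ln_khinchine_const by (simp_all add: c_def M_def)
  define m where "m = real (Suc j)"
  have m: "m \<ge> 1" by (simp add: m_def)
  have "1 - c / m \<le> exp (- (c / m))"
    using exp_ge_add_one_self[of "- (c / m)"] by simp
  also have "\<dots> = M powr (- (1 / m))"
    using M by (simp add: powr_def c_def)
  finally have "M powr harm (Suc j) * (1 - M powr (- (1 / m))) \<le> M powr harm (Suc j) * (c / m)"
    by (intro mult_left_mono) auto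
  moreover have "M powr harm (Suc j) * M powr (- (1 / m)) = M powr harm j"
    by (simp add: harm_Suc m_def inverse_eq_divide flip: powr_add)
  ultimately have "M powr harm (Suc j) - M powr harm j \<le> M powr harm (Suc j) * (c / m)"
    by (simp add: algebra_simps)
  also have "\<dots> \<le> M powr (1 + ln m) * (c / m)"
    using harm_le_one_plus_ln[of "Suc j"] c m M
    by (intro mult_right_mono powr_mono) (auto simp: m_def M_def khinchine_const_def)
  also have "M powr (1 + ln m) = M * m powr c"
    using M m by (simp add: powr_def c_def distrib_left exp_add mult.commute)
  also have "M * m powr c * (c / m) = (M * c) * (m powr c / m)"
    by simp
  also have "\<dots> \<le> 409 / 1000 * (m powr (302 / 1000) / m)"
  proof (intro mult_mono divide_right_mono powr_mono c)
    have "M * c \<le> M * (302 / 1000)" using c M by (intro mult_left_mono) auto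
    then show "M * c \<le> 409 / 1000" by (simp add: M_def khinchine_const_def)
  qed (use m in auto)
  also have "m powr (302 / 1000) / m = m powr (302 / 1000 - 1)"
    by (subst powr_diff) (use m in simp)
  finally show ?thesis by (simp add: M_def m_def)
qed

lemma BH_const_le_sum:
  assumes "n \<ge> 1"
  shows "BH_const n \<le> 1 + 409 / 1000 * (\<Sum>j = 1..n - 1. real j powr (302 / 1000 - 1))"
proof -
  have "khinchine_const powr harm k \<le> 1 + 409 / 1000 * (\<Sum>j = 1..k. real j powr (302 / 1000 - 1))" for k
  proof (induction k)
    case 0
    then show ?case by (simp add: harm_def khinchine_const_def)
  next
    case (Suc k)
    then show ?case
      using khinchine_const_powr_harm_increment[of k] by (simp add: algebra_simps)
  qed
  moreover have "BH_const n \<le> khinchine_const powr harm (n - 1)"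
    using BH_admissible_harm[of "n - 1"] assms by (intro BH_const_le) auto
  ultimately show ?thesis by (rule order_trans[rotated])
qed

text \<open>
  The true values are about \<open>0.5772\<close> and \<open>0.30498\<close>, so \<open>0.302\<close> leaves little room; comparing with the
  fifteenth harmonic number makes the logarithm a multiple of \<open>ln 2\<close>.
\<close>

lemma euler_mascheroni_numeric_bounds:
  "(euler_mascheroni :: real) \<le> 58 / 100" "302 / 1000 \<le> (1 - euler_mascheroni) / (2 * ln (2::real))"
proof -
  have ln2: "693 / 1000 \<le> ln (2::real)" "ln (2::real) \<le> 6935 / 10000"
    using ln_approx_bounds[of 2 3] by (simp_all add: eval_nat_numeral)
  have "ln (16::real) = 4 * ln 2"
    using ln_realpow[of 2 4] by simp
  then have "(euler_mascheroni :: real) \<le> harm 15 - 4 * ln 2 + 1 / 30"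
    using euler_mascheroni_upper[of 14] by simp
  also have "harm 15 = (1195757 / 360360 :: real)"
    by (simp add: harm_expand)
  finally show \<gamma>: "(euler_mascheroni :: real) \<le> 58 / 100"
    using ln2(1) by simp
  have "302 / 1000 * (2 * ln (2::real)) \<le> 302 / 1000 * (2 * (6935 / 10000))"
    using ln2(2) by simp
  also have "\<dots> \<le> 1 - euler_mascheroni" using \<gamma> by simp
  finally show "302 / 1000 \<le> (1 - euler_mascheroni) / (2 * ln (2::real))"
    by (simp add: le_divide_eq)
qed

lemma bound_coefficient_numeric:
  "409 / 1000 < 4 / sqrt pi * (1 - exp (euler_mascheroni / 2 - 1 / 2))"
proof -
  \<comment> \<open>Dropping the subtracted term in Machin's formula gives \<open>pi \<le> 16 / 5\<close>.\<close>
  have "pi / 4 \<le> 4 * (1 / 5 :: real)"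
  proof -
    have "arctan (1 / 5) \<le> 1 / 5"
      by (rule arctan_le_self) linarith
    moreover have "0 \<le> arctan (1 / 239)"
      unfolding zero_le_arctan_iff by linarith
    ultimately show ?thesis using machin by linarith
  qed
  then have "pi \<le> (179 / 100)\<^sup>2" by (simp add: power2_eq_square)
  then have "sqrt pi \<le> 179 / 100" by (intro real_le_lsqrt) auto
  then have pi: "4 / (179 / 100) \<le> 4 / sqrt pi"
    by (intro divide_left_mono) auto
  define x where "x = (1 - euler_mascheroni) / (2 :: real)"
  have "21 / 100 \<le> x" using euler_mascheroni_numeric_bounds(1) by (simp add: x_def)
  then have "exp (21 / 100) \<le> exp x" by simp
  moreover have "1 + 21 / 100 + (21 / 100)\<^sup>2 / 2 \<le> exp (21 / 100 :: real)"
    by (rule exp_lower_Taylor_quadratic) simp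
  ultimately have "1 + 21 / 100 + (21 / 100)\<^sup>2 / 2 \<le> exp x" by linarith
  then have "exp (- x) \<le> 1 / (1 + 21 / 100 + (21 / 100)\<^sup>2 / 2)"
    by (simp add: exp_minus inverse_eq_divide divide_simps)
  then have "1 - exp (- x) \<ge> 185 / 1000" by (simp add: power2_eq_square)
  moreover have "- x = euler_mascheroni / 2 - 1 / 2" by (simp add: x_def field_simps)
  ultimately have "4 / (179 / 100) * (185 / 1000) \<le> 4 / sqrt pi * (1 - exp (euler_mascheroni / 2 - 1 / 2))"
    using pi by (intro mult_mono) auto
  moreover have "409 / 1000 < 4 / (179 / 100) * (185 / 1000 :: real)" by simp
  ultimately show ?thesis by (rule less_le_trans[rotated])
qed

lemma BH_const_less:
  assumes n: "n \<ge> 2" and A: "409 / 1000 < A" and \<alpha>: "302 / 1000 - 1 \<le> \<alpha>"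
  shows "BH_const n < 1 + A * (\<Sum>j = 1..n - 1. real j powr \<alpha>)"
proof -
  have "(\<Sum>j = 1..n - 1. real j powr (302 / 1000 - 1)) \<le> (\<Sum>j = 1..n - 1. real j powr \<alpha>)"
    using \<alpha> by (intro sum_mono powr_mono) auto
  then have "409 / 1000 * (\<Sum>j = 1..n - 1. real j powr (302 / 1000 - 1)) \<le> 409 / 1000 * (\<Sum>j = 1..n - 1. real j powr \<alpha>)"
    by (intro mult_left_mono) auto
  also have "\<dots> < A * (\<Sum>j = 1..n - 1. real j powr \<alpha>)"
    using n A by (intro mult_strict_right_mono sum_pos) auto
  finally show ?thesis
    using BH_const_le_sum[of n] n by simp
qed

theorem mainTheorem6:
  fixes n :: nat
  assumes "n \<ge> 2"
  shows "BH_const n < 1 + 4 / sqrt pi * (1 - exp (euler_mascheroni / 2 - 1 / 2)) *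
           (\<Sum>j = 1..n - 1. real j powr (log 2 (exp (- euler_mascheroni / 2 + 1 / 2)) - 1))
       \<and> BH_const n < 1 + 0.44 * (\<Sum>j = 1..n - 1. 1 / real j powr 0.695025)"
proof
  have "log 2 (exp (- euler_mascheroni / 2 + 1 / 2)) = (1 - euler_mascheroni) / (2 * ln (2::real))"
    by (simp add: log_def field_simps)
  then show "BH_const n < 1 + 4 / sqrt pi * (1 - exp (euler_mascheroni / 2 - 1 / 2)) *
           (\<Sum>j = 1..n - 1. real j powr (log 2 (exp (- euler_mascheroni / 2 + 1 / 2)) - 1))"
    using euler_mascheroni_numeric_bounds(2)
    by (intro BH_const_less[OF assms bound_coefficient_numeric]) linarith
  have "BH_const n < 1 + 0.44 * (\<Sum>j = 1..n - 1. real j powr (- 0.695025))"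
    by (intro BH_const_less[OF assms]) simp_all
  then show "BH_const n < 1 + 0.44 * (\<Sum>j = 1..n - 1. 1 / real j powr 0.695025)"
    by (simp add: powr_minus_divide)
qed

end
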